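(* Let $K$ be a field, $S=K[y_1,\dots,y_s]$, $d>0$ an integer, and $\mathcal{V}=(\boldsymbol{v}_1,\dots,\boldsymbol{v}_s)$ a $d\times s$ integer matrix with columns $\boldsymbol{v}_i\in\mathbb{Z}^d$; equip $S$ with the $\mathbb{Z}^d$-grading $\deg_{\mathbb{Z}^d}(y_i)=\boldsymbol{v}_i$. Let $\mathfrak{H}$ be a finitely generated subsemigroup of $\mathbb{N}\mathcal{V}$ such that the semigroup $\widetilde{\mathfrak{H}}=\{\boldsymbol{a}\in\mathbb{N}^s\mid\mathcal{V}\cdot\boldsymbol{a}\in\mathfrak{H}\}$ is finitely generated, let $\mathcal{A}_{\mathfrak{H}}=\{\boldsymbol{a}^{(1)},\dots,\boldsymbol{a}^{(r)}\}\subset\mathbb{N}^s$ be a system of generators of $\widetilde{\mathfrak{H}}$ as a semigroup, let $R^{[\mathfrak{H}]}=K[x_1,\dots,x_r]$, and let $\phi_{\mathcal{A}_{\mathfrak{H}}}:R^{[\mathfrak{H}]}\to S$, $x_i\mapsto\boldsymbol{y}^{\boldsymbol{a}^{(i)}}$. Put $P_{\mathcal{A}_{\mathfrak{H}}}=\operatorname{Ker}\phi_{\mathcal{A}_{\mathfrak{H}}}$. Let $I\subset S$ be a $\mathbb{Z}^d$-graded ideal, $\prec$ a term order on $R^{[\mathfrak{H}]}$, and $\boldsymbol{w}\in\mathbb{N}^s$ a weight vector on $S$ such that $\operatorname{in}_{\boldsymbol{w}}(I)$ is a monomial ideal. Let $\boldsymbol{w}'=(\deg_{\boldsymbol{w}}\phi_{\mathcal{A}_{\mathfrak{H}}}(x_1),\dots,\deg_{\boldsymbol{w}}\phi_{\mathcal{A}_{\mathfrak{H}}}(x_r))$.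 Then the following hold. (1) $\delta(\operatorname{in}_{\prec_{\boldsymbol{w}'}}(\phi_{\mathcal{A}_{\mathfrak{H}}}^{-1}(I)))\le\max\{\delta(\operatorname{in}_{\boldsymbol{w}}(I)),\ \delta(\operatorname{in}_\prec(P_{\mathcal{A}_{\mathfrak{H}}}))\}$. (2) If both $\operatorname{in}_{\boldsymbol{w}}(I)$ and $\operatorname{in}_\prec(P_{\mathcal{A}_{\mathfrak{H}}})$ are generated by square-free monomials, then $\operatorname{in}_{\prec_{\boldsymbol{w}'}}(\phi_{\mathcal{A}_{\mathfrak{H}}}^{-1}(I))$ is generated by square-free monomials.
   Context: $\mathbb{N}=\{0,1,2,\dots\}$; $\mathbb{N}\mathcal{V}=\{\sum_i n_i\boldsymbol{v}_i\mid n_i\in\mathbb{N}\}$. Semigroups are understood to contain $0$. For a monomial ideal $J$, $\delta(J)$ is the maximum of the degrees of the minimal monomial generators of $J$ (with $\delta(0)=0$). For a weight vector $\boldsymbol{w}\in\mathbb{N}^s$, the weight of $\boldsymbol{y}^{\boldsymbol{a}}$ is $\deg_{\boldsymbol{w}}(\boldsymbol{y}^{\boldsymbol{a}})=\boldsymbol{w}\cdot\boldsymbol{a}$; $\operatorname{in}_{\boldsymbol{w}}(f)$ is the sum of all terms of $f$ of highest weight, and $\operatorname{in}_{\boldsymbol{w}}(I)=\langle\operatorname{in}_{\boldsymbol{w}}(f)\mid f\in I\rangle$. For a term order $\prec$, $\operatorname{in}_\prec(I)$ is the usual initial ideal. The term order $\prec_{\boldsymbol{w}'}$ is defined by: $\boldsymbol{x}^{\boldsymbol{a}}\prec_{\boldsymbol{w}'}\boldsymbol{x}^{\boldsymbol{b}}$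 if $\boldsymbol{w}'\cdot\boldsymbol{a}<\boldsymbol{w}'\cdot\boldsymbol{b}$, or $\boldsymbol{w}'\cdot\boldsymbol{a}=\boldsymbol{w}'\cdot\boldsymbol{b}$ and $\boldsymbol{x}^{\boldsymbol{a}}\prec\boldsymbol{x}^{\boldsymbol{b}}$. *)

theory Defs
  imports
    "HOL-Library.Poly_Mapping"
    "HOL-Algebra.RingHom"
    "HOL-Analysis.Finite_Cartesian_Product"
begin

section \<open>Polynomial rings in finitely many variables\<close>

text \<open>
  A monomial is identified with its exponent vector, and a polynomial over \<open>'k\<close> with the
  finitely supported function giving its coefficients; the library's addition and convolution
  product on such functions are the ring operations. The variables are numbered from 0, and
  the polynomial ring in \<open>n\<close> variables is carved out as the set of polynomials in which only
  the variables \<open>0, \<dots>, n - 1\<close> occur, so that every \<open>n\<close>, including 0, is covered.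
\<close>

type_synonym monomial = "nat \<Rightarrow>\<^sub>0 nat"
type_synonym 'k mpoly = "monomial \<Rightarrow>\<^sub>0 'k"

definition monomials :: "nat \<Rightarrow> monomial set" where
  "monomials n = {a. Poly_Mapping.keys a \<subseteq> {..<n}}"

definition mpoly_ring :: "nat \<Rightarrow> 'k::field mpoly ring" where
  "mpoly_ring n = \<lparr>carrier = {f. Poly_Mapping.keys f \<subseteq> monomials n},
     monoid.mult = (*), one = 1, zero = 0, add = (+)\<rparr>"

lemma cring_mpoly_ring: "cring (mpoly_ring n :: 'k::field mpoly ring)"
proof -
  have zero: "(0::monomial) \<in> monomials n"
    by (simp add: monomials_def)
  have plus: "a + b \<in> monomials n" if "a \<in> monomials n" "b \<in> monomials n" for a b
    using that Poly_Mapping.keys_add[of a b] by (auto simp: monomials_def)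
  show ?thesis
  proof (intro cringI abelian_groupI comm_monoidI)
    fix x assume "x \<in> carrier (mpoly_ring n :: 'k mpoly ring)"
    then show "\<exists>y\<in>carrier (mpoly_ring n). y \<oplus>\<^bsub>mpoly_ring n\<^esub> x = \<zero>\<^bsub>mpoly_ring n\<^esub>"
      by (intro bexI[of _ "- x"])
        (auto simp: mpoly_ring_def in_keys_iff subset_iff)
  next
    fix x y :: "'k mpoly"
    assume "x \<in> carrier (mpoly_ring n)" "y \<in> carrier (mpoly_ring n)"
    then show "x \<oplus>\<^bsub>mpoly_ring n\<^esub> y \<in> carrier (mpoly_ring n)"
      using Poly_Mapping.keys_add[of x y] by (auto simp: mpoly_ring_def)
  next
    fix x y :: "'k mpoly"
    assume "x \<in> carrier (mpoly_ring n)" "y \<in> carrier (mpoly_ring n)"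
    then show "x \<otimes>\<^bsub>mpoly_ring n\<^esub> y \<in> carrier (mpoly_ring n)"
      using keys_mult[of x y] plus by (fastforce simp: mpoly_ring_def)
  qed (use zero in \<open>auto simp: mpoly_ring_def algebra_simps\<close>)
qed

definition monomial_poly :: "monomial \<Rightarrow> 'k::field mpoly" where
  "monomial_poly a = Poly_Mapping.single a 1"

definition terms_such_that :: "(monomial \<Rightarrow> bool) \<Rightarrow> 'k::field mpoly \<Rightarrow> 'k mpoly" where
  "terms_such_that P f =
     (\<Sum>a\<in>{a \<in> Poly_Mapping.keys f. P a}. Poly_Mapping.single a (Poly_Mapping.lookup f a))"

definition substitute :: "(nat \<Rightarrow> 'k::field mpoly) \<Rightarrow> 'k mpoly \<Rightarrow> 'k mpoly" where
  "substitute g f = (\<Sum>b\<in>Poly_Mapping.keys f. Poly_Mapping.single 0 (Poly_Mapping.lookup f b) *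
     (\<Prod>i\<in>Poly_Mapping.keys b. g i ^ Poly_Mapping.lookup b i))"

section \<open>Monomial ideals\<close>

definition monomial_ideal :: "nat \<Rightarrow> 'k::field mpoly set \<Rightarrow> bool" where
  "monomial_ideal n J \<longleftrightarrow> (\<exists>M \<subseteq> monomials n. J = Idl\<^bsub>mpoly_ring n\<^esub> (monomial_poly ` M))"

definition squarefree_monomial_ideal :: "nat \<Rightarrow> 'k::field mpoly set \<Rightarrow> bool" where
  "squarefree_monomial_ideal n J \<longleftrightarrow>
     (\<exists>M \<subseteq> {a \<in> monomials n. \<forall>i. Poly_Mapping.lookup a i \<le> 1}. J = Idl\<^bsub>mpoly_ring n\<^esub> (monomial_poly ` M))"

text \<open>
  The minimal monomial generators of a monomial ideal are the monomials in it that are minimal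
  with respect to divisibility. Divisibility is spelled out componentwise because the order
  that the library puts on finitely supported functions is lexicographic.
\<close>

definition minimal_monomial_generators :: "nat \<Rightarrow> 'k::field mpoly set \<Rightarrow> monomial set" where
  "minimal_monomial_generators n J =
     {a \<in> monomials n. monomial_poly a \<in> J \<and>
       (\<forall>b\<in>monomials n. monomial_poly b \<in> J \<and> (\<forall>i. Poly_Mapping.lookup b i \<le> Poly_Mapping.lookup a i)
          \<longrightarrow> b = a)}"

definition weight :: "(nat \<Rightarrow> nat) \<Rightarrow> monomial \<Rightarrow> nat" where
  "weight w a = (\<Sum>i\<in>Poly_Mapping.keys a. w i * Poly_Mapping.lookup a i)"

text \<open>
  By Dickson's lemma the set under \<open>Max\<close> is finite, and it is nonempty for a nonzero
  monomial ideal.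
\<close>

definition delta :: "nat \<Rightarrow> 'k::field mpoly set \<Rightarrow> nat" where
  "delta n J = (if J = {0} then 0 else Max (weight (\<lambda>_. 1) ` minimal_monomial_generators n J))"

section \<open>Initial ideals\<close>

definition initial_form :: "(nat \<Rightarrow> nat) \<Rightarrow> 'k::field mpoly \<Rightarrow> 'k mpoly" where
  "initial_form w f =
     terms_such_that (\<lambda>a. weight w a = Max (weight w ` Poly_Mapping.keys f)) f"

definition weight_initial_ideal ::
    "nat \<Rightarrow> (nat \<Rightarrow> nat) \<Rightarrow> 'k::field mpoly set \<Rightarrow> 'k mpoly set" where
  "weight_initial_ideal n w I = Idl\<^bsub>mpoly_ring n\<^esub> (initial_form w ` I)"

text \<open>Term orders are given by their strict part.\<close>

definition term_order :: "nat \<Rightarrow> (monomial \<Rightarrow> monomial \<Rightarrow> bool) \<Rightarrow> bool" where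
  "term_order n lt \<longleftrightarrow>
     irreflp_on (monomials n) lt \<and> transp_on (monomials n) lt \<and> totalp_on (monomials n) lt \<and>
     (\<forall>a\<in>monomials n. a \<noteq> 0 \<longrightarrow> lt 0 a) \<and>
     (\<forall>a\<in>monomials n. \<forall>b\<in>monomials n. \<forall>c\<in>monomials n. lt a b \<longrightarrow> lt (a + c) (b + c))"

definition is_leading_monomial ::
    "(monomial \<Rightarrow> monomial \<Rightarrow> bool) \<Rightarrow> 'k::field mpoly \<Rightarrow> monomial \<Rightarrow> bool" where
  "is_leading_monomial lt f a \<longleftrightarrow>
     a \<in> Poly_Mapping.keys f \<and> (\<forall>b\<in>Poly_Mapping.keys f. b \<noteq> a \<longrightarrow> lt b a)"

definition initial_ideal ::
    "nat \<Rightarrow> (monomial \<Rightarrow> monomial \<Rightarrow> bool) \<Rightarrow> 'k::field mpoly set \<Rightarrow> 'k mpoly set" where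
  "initial_ideal n lt I = Idl\<^bsub>mpoly_ring n\<^esub> {monomial_poly a | a. \<exists>f\<in>I. is_leading_monomial lt f a}"

definition weight_order ::
    "(nat \<Rightarrow> nat) \<Rightarrow> (monomial \<Rightarrow> monomial \<Rightarrow> bool) \<Rightarrow> monomial \<Rightarrow> monomial \<Rightarrow> bool" where
  "weight_order w lt a b \<longleftrightarrow> weight w a < weight w b \<or> (weight w a = weight w b \<and> lt a b)"

section \<open>The multigrading and semigroups\<close>

text \<open>
  \<open>multidegree v a\<close> is the vector $\mathcal{V} \cdot a$, where \<open>v i\<close> is the \<open>i\<close>-th column of
  $\mathcal{V}$; only the columns with index in the support of \<open>a\<close> matter.
\<close>

definition multidegree :: "(nat \<Rightarrow> int ^ 'd) \<Rightarrow> monomial \<Rightarrow> int ^ 'd" where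
  "multidegree v a = (\<Sum>i\<in>Poly_Mapping.keys a. int (Poly_Mapping.lookup a i) *s v i)"

definition graded_ideal :: "nat \<Rightarrow> (nat \<Rightarrow> int ^ 'd) \<Rightarrow> 'k::field mpoly set \<Rightarrow> bool" where
  "graded_ideal n v I \<longleftrightarrow> ideal I (mpoly_ring n) \<and>
     (\<forall>f\<in>I. \<forall>u. terms_such_that (\<lambda>a. multidegree v a = u) f \<in> I)"

text \<open>Semigroups contain 0.\<close>

definition subsemigroup :: "'a::comm_monoid_add set \<Rightarrow> bool" where
  "subsemigroup H \<longleftrightarrow> 0 \<in> H \<and> (\<forall>a\<in>H. \<forall>b\<in>H. a + b \<in> H)"

definition finitely_generated_semigroup :: "'a::comm_monoid_add set \<Rightarrow> bool" where
  "finitely_generated_semigroup H \<longleftrightarrow> (\<exists>G. finite G \<and> H = subsemigroup hull G)"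

definition column_semigroup :: "nat \<Rightarrow> (nat \<Rightarrow> int ^ 'd) \<Rightarrow> (int ^ 'd) set" where
  "column_semigroup s v = {\<Sum>i<s. int (n i) *s v i | n :: nat \<Rightarrow> nat. True}"

definition lifted_semigroup ::
    "nat \<Rightarrow> (nat \<Rightarrow> int ^ 'd) \<Rightarrow> (int ^ 'd) set \<Rightarrow> monomial set" where
  "lifted_semigroup s v H = {a \<in> monomials s. multidegree v a \<in> H}"

section \<open>The monomial map and contraction ideals\<close>

definition monomial_map :: "(nat \<Rightarrow> monomial) \<Rightarrow> 'k::field mpoly \<Rightarrow> 'k mpoly" where
  "monomial_map a = substitute (\<lambda>i. monomial_poly (a i))"

definition toric_ideal :: "nat \<Rightarrow> nat \<Rightarrow> (nat \<Rightarrow> monomial) \<Rightarrow> 'k::field mpoly set" where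
  "toric_ideal r s a = a_kernel (mpoly_ring r) (mpoly_ring s) (monomial_map a)"

definition contraction :: "nat \<Rightarrow> (nat \<Rightarrow> monomial) \<Rightarrow> 'k::field mpoly set \<Rightarrow> 'k mpoly set" where
  "contraction r a I = {f \<in> carrier (mpoly_ring r). monomial_map a f \<in> I}"

end

theory Submission
  imports Defs
begin

text \<open>
  Write $A b$ for the exponent vector of the image of the monomial $x^b$ (\<open>exponent_map\<close>), $P$ for the toric
  ideal and $J$ for the contraction of $I$. The proof rests on a description of the leading monomials
  of $J$ for the weight order (\<open>leading_monomials_contraction_iff\<close>): $x^b$ is one of them iff $x^b$ is a
  leading monomial of $P$ or $y^{A b}$ lies in the initial ideal of $I$ with respect to the weight.
  The grading enters here: the graded piece of an element of $I$ in the multidegree of $A b$ involves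
  only monomials in the image of the monomial map, and so can be lifted to $J$.

  Both claims follow by combinatorics of monomials. If $y^m$ divides $y^{A b}$, then $x^b$ has a divisor
  $x^{b'}$ of degree at most that of $m$ with $y^m$ still dividing $y^{A b'}$
  (\<open>small_divisor_with_divisible_image\<close>); and if $m$ is square-free, then $b'$ can be taken to be the
  radical of $b$ (\<open>squarefree_dvd_exponent_map_radical\<close>). So a minimal generator of the initial ideal of $J$
  either is a minimal generator of that of $P$, or has degree at most that of a minimal
  generator of that of $I$. In the square-free case the leading monomials of $J$ are closed under
  radicals, so the square-free ones among them generate.
\<close>

section \<open>Monomials and divisibility\<close>

lemma zero_in_monomials [simp]: "0 \<in> monomials n"
  by (simp add: monomials_def)

lemma add_in_monomials: "a + b \<in> monomials n \<longleftrightarrow> a \<in> monomials n \<and> b \<in> monomials n"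
proof -
  have "Poly_Mapping.keys (a + b) = Poly_Mapping.keys a \<union> Poly_Mapping.keys b"
    by (auto simp: in_keys_iff lookup_add)
  then show ?thesis by (simp add: monomials_def)
qed

text \<open>
  A relation of its own is needed because \<open>\<le>\<close> on finitely supported functions is a linear order,
  not divisibility of monomials.
\<close>
definition monomial_dvd :: "monomial \<Rightarrow> monomial \<Rightarrow> bool" where
  "monomial_dvd a b \<longleftrightarrow> (\<forall>i. Poly_Mapping.lookup a i \<le> Poly_Mapping.lookup b i)"

lemma monomial_dvdE:
  assumes "monomial_dvd a b"
  obtains c where "b = a + c"
proof
  show "b = a + (b - a)"
    using assms by (intro poly_mapping_eqI) (simp add: monomial_dvd_def lookup_add lookup_minus)
qed

lemma monomial_dvd_add [simp]: "monomial_dvd a (a + c)" "monomial_dvd a (c + a)"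
  by (simp_all add: monomial_dvd_def lookup_add)

lemma monomial_dvd_refl [simp]: "monomial_dvd a a"
  by (simp add: monomial_dvd_def)

lemma monomial_dvd_trans: "monomial_dvd a b \<Longrightarrow> monomial_dvd b c \<Longrightarrow> monomial_dvd a c"
  unfolding monomial_dvd_def by (meson order_trans)

lemma monomial_dvd_in_monomials: "monomial_dvd a b \<Longrightarrow> b \<in> monomials n \<Longrightarrow> a \<in> monomials n"
  by (metis monomial_dvdE add_in_monomials)

lemma weight_zero [simp]: "weight w 0 = 0"
  by (simp add: weight_def)

lemma weight_add: "weight w (a + b) = weight w a + weight w b"
  unfolding weight_def
  by (rule setsum_keys_plus_distrib[where f = "\<lambda>i n. w i * n"]) (simp_all add: algebra_simps)

lemma weight_single [simp]: "weight w (Poly_Mapping.single i n) = w i * n"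
  by (cases "n = 0") (simp_all add: weight_def)

lemma total_degree_eq_0_iff: "weight (\<lambda>_. 1) a = 0 \<longleftrightarrow> a = 0"
proof
  assume "weight (\<lambda>_. 1) a = 0"
  then have "Poly_Mapping.lookup a i = 0" for i
    by (cases "i \<in> Poly_Mapping.keys a") (auto simp: weight_def in_keys_iff)
  then show "a = 0" by (intro poly_mapping_eqI) simp
qed simp

section \<open>Dickson's lemma and minimal generators\<close>

text \<open>
  A monotone subsequence always exists; if it is decreasing it is eventually constant, so its tail
  is increasing.
\<close>
lemma nat_sequence_has_incseq_subsequence:
  fixes f :: "nat \<Rightarrow> nat"
  obtains g where "strict_mono g" "incseq (f \<circ> g)"
proof -
  obtain g where g: "strict_mono g" "monoseq (\<lambda>n. f (g n))"
    using seq_monosub by blast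
  show ?thesis
  proof (cases "incseq (\<lambda>n. f (g n))")
    case True
    with g show ?thesis by (intro that[of g]) (auto simp: comp_def)
  next
    case False
    with g have dec: "decseq (\<lambda>n. f (g n))" by (simp add: monoseq_iff)
    define m where "m = (LEAST v. v \<in> range (\<lambda>n. f (g n)))"
    have "m \<in> range (\<lambda>n. f (g n))" unfolding m_def by (rule LeastI[of _ "f (g 0)"]) simp
    then obtain N where N: "m = f (g N)" by auto
    have const: "f (g n) = m" if "n \<ge> N" for n
    proof (rule antisym)
      show "f (g n) \<le> m" using dec that N by (simp add: decseq_def)
      show "m \<le> f (g n)" unfolding m_def by (rule Least_le) simp
    qed
    show ?thesis
    proof (rule that[of "\<lambda>n. g (N + n)"])
      show "strict_mono (\<lambda>n. g (N + n))" using g(1) by (simp add: strict_mono_def)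
      show "incseq (f \<circ> (\<lambda>n. g (N + n)))" by (simp add: incseq_def const)
    qed
  qed
qed

text \<open>
  Passing to a further subsequence makes one more exponent increasing and keeps the earlier ones
  increasing.
\<close>
lemma monomial_sequence_has_increasing_subsequence:
  fixes f :: "nat \<Rightarrow> monomial"
  shows "\<exists>g. strict_mono g \<and> (\<forall>i<n. incseq (\<lambda>k. Poly_Mapping.lookup (f (g k)) i))"
proof (induction n)
  case 0
  show ?case by (intro exI[of _ id]) (auto simp: strict_mono_def)
next
  case (Suc n)
  then obtain g where g: "strict_mono g" "\<forall>i<n. incseq (\<lambda>k. Poly_Mapping.lookup (f (g k)) i)"
    by blast
  obtain h where h: "strict_mono h" "incseq ((\<lambda>k. Poly_Mapping.lookup (f (g k)) n) \<circ> h)"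
    by (rule nat_sequence_has_incseq_subsequence)
  have "incseq (\<lambda>k. Poly_Mapping.lookup (f (g (h k))) i)" if "i < Suc n" for i
  proof (cases "i = n")
    case True
    with h show ?thesis by (simp add: comp_def)
  next
    case False
    with that g(2) have "incseq (\<lambda>k. Poly_Mapping.lookup (f (g k)) i)" by simp
    with h(1) show ?thesis
      by (simp add: incseq_def strict_mono_less_eq)
  qed
  moreover have "strict_mono (\<lambda>k. g (h k))"
    using g(1) h(1) by (simp add: strict_mono_def)
  ultimately show ?case by blast
qed

text \<open>
  Dickson's lemma. It is what makes the maximum in \<^const>\<open>delta\<close> range over a finite set.
\<close>
lemma finite_monomial_antichain:
  assumes "A \<subseteq> monomials n" and antichain: "\<And>a b. a \<in> A \<Longrightarrow> b \<in> A \<Longrightarrow> monomial_dvd a b \<Longrightarrow> a = b"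
  shows "finite A"
proof (rule ccontr)
  assume "infinite A"
  then obtain f :: "nat \<Rightarrow> monomial" where f: "inj f" "range f \<subseteq> A"
    using infinite_countable_subset by blast
  obtain g where g: "strict_mono g" "\<forall>i<n. incseq (\<lambda>k. Poly_Mapping.lookup (f (g k)) i)"
    using monomial_sequence_has_increasing_subsequence by blast
  have fA: "f k \<in> A" for k using f(2) by auto
  have "Poly_Mapping.lookup (f (g 0)) i \<le> Poly_Mapping.lookup (f (g 1)) i" for i
  proof (cases "i < n")
    case True
    with g(2) show ?thesis by (simp add: incseq_def)
  next
    case False
    moreover have "f (g 0) \<in> monomials n" using fA assms(1) by blast
    ultimately have "Poly_Mapping.lookup (f (g 0)) i = 0"
      by (auto simp: monomials_def in_keys_iff)
    then show ?thesis by simp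
  qed
  then have "f (g 0) = f (g 1)"
    by (intro antichain fA) (simp add: monomial_dvd_def)
  then have "g 0 = g 1" using f(1) by (simp add: inj_eq)
  then show False using g(1) by (simp add: strict_mono_eq)
qed

lemma minimal_monomial_generators_iff:
  "m \<in> minimal_monomial_generators n J \<longleftrightarrow> m \<in> monomials n \<and> monomial_poly m \<in> J \<and>
     (\<forall>b. monomial_poly b \<in> J \<and> monomial_dvd b m \<longrightarrow> b = m)"
  unfolding minimal_monomial_generators_def monomial_dvd_def[symmetric]
  using monomial_dvd_in_monomials by blast

lemma finite_minimal_monomial_generators: "finite (minimal_monomial_generators n J)"
  by (rule finite_monomial_antichain[of _ n]) (auto simp: minimal_monomial_generators_iff)

text \<open>
  A proper divisor has smaller total degree, so the descent through divisors in the ideal ends.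
\<close>
lemma obtain_minimal_monomial_generator:
  assumes "b \<in> monomials n" "monomial_poly b \<in> J"
  obtains m where "m \<in> minimal_monomial_generators n J" "monomial_dvd m b"
proof -
  have "\<exists>m. m \<in> minimal_monomial_generators n J \<and> monomial_dvd m b"
    using assms
  proof (induction "weight (\<lambda>_. 1) b" arbitrary: b rule: less_induct)
    case less
    show ?case
    proof (cases "b \<in> minimal_monomial_generators n J")
      case True
      then show ?thesis using monomial_dvd_refl by blast
    next
      case False
      then obtain c where c: "monomial_poly c \<in> J" "monomial_dvd c b" "c \<noteq> b"
        using less.prems by (auto simp: minimal_monomial_generators_iff)
      then obtain d where d: "b = c + d" by (elim monomial_dvdE)
      with c(3) have "d \<noteq> 0" by auto
      then have "weight (\<lambda>_. 1) d \<noteq> 0" by (metis total_degree_eq_0_iff)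
      then have "weight (\<lambda>_. 1) c < weight (\<lambda>_. 1) b" by (simp add: d weight_add)
      moreover have "c \<in> monomials n" using less.prems d by (simp add: add_in_monomials)
      ultimately show ?thesis using less.hyps c monomial_dvd_trans by blast
    qed
  qed
  then show ?thesis using that by blast
qed

lemma monomial_poly_neq_0 [simp]: "monomial_poly a \<noteq> (0 :: 'k::field mpoly)"
  by (metis lookup_single_eq lookup_zero monomial_poly_def zero_neq_one)

lemma degree_le_delta:
  assumes "m \<in> minimal_monomial_generators n (J :: 'k::field mpoly set)"
  shows "weight (\<lambda>_. 1) m \<le> delta n J"
proof -
  have "J \<noteq> {0}" using assms by (auto simp: minimal_monomial_generators_iff)
  then show ?thesis
    using assms by (simp add: delta_def finite_minimal_monomial_generators)
qed

section \<open>Polynomials and ideals\<close>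

lemma mpoly_ring_simps [simp]:
  "f \<in> carrier (mpoly_ring n) \<longleftrightarrow> Poly_Mapping.keys f \<subseteq> monomials n"
  "\<zero>\<^bsub>mpoly_ring n\<^esub> = 0" "x \<oplus>\<^bsub>mpoly_ring n\<^esub> y = x + y" "x \<otimes>\<^bsub>mpoly_ring n\<^esub> y = x * y"
  by (simp_all add: mpoly_ring_def)

lemma ring_mpoly_ring: "ring (mpoly_ring n :: 'k::field mpoly ring)"
  using cring_mpoly_ring cring.axioms(1) by blast

lemma lookup_single_times_add:
  "Poly_Mapping.lookup (Poly_Mapping.single b c * g) (b + k) = c * Poly_Mapping.lookup g k"
  for g :: "'k::field mpoly"
  by (simp add: lookup_mult lookup_single when_mult)

lemma in_keys_single_times:
  assumes "k \<in> Poly_Mapping.keys (Poly_Mapping.single b c * g :: 'k::field mpoly)"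
  obtains k' where "k = b + k'" "k' \<in> Poly_Mapping.keys g"
  using assms keys_mult[of "Poly_Mapping.single b c" g] by (auto split: if_splits)

lemma keys_single_times:
  "Poly_Mapping.keys (Poly_Mapping.single b c * g :: 'k::field mpoly) =
     (if c = 0 then {} else (+) b ` Poly_Mapping.keys g)"
proof (cases "c = 0")
  case False
  then have "b + k \<in> Poly_Mapping.keys (Poly_Mapping.single b c * g)" if "k \<in> Poly_Mapping.keys g" for k
    using that by (simp add: in_keys_iff lookup_single_times_add)
  with False show ?thesis by (auto elim: in_keys_single_times)
qed simp

lemma mpoly_eq_sum_of_terms:
  "f = (\<Sum>k\<in>Poly_Mapping.keys f. Poly_Mapping.single k (Poly_Mapping.lookup f k))"
  for f :: "'k::field mpoly"
proof (rule poly_mapping_eqI)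
  fix k
  show "Poly_Mapping.lookup f k =
     Poly_Mapping.lookup (\<Sum>k\<in>Poly_Mapping.keys f. Poly_Mapping.single k (Poly_Mapping.lookup f k)) k"
    by (cases "k \<in> Poly_Mapping.keys f")
      (auto simp: lookup_sum lookup_single when_def in_keys_iff)
qed

lemma lookup_terms_such_that:
  "Poly_Mapping.lookup (terms_such_that P f) k = (if P k then Poly_Mapping.lookup f k else 0)"
  by (simp add: terms_such_that_def lookup_sum lookup_single when_def in_keys_iff)

lemma keys_terms_such_that: "Poly_Mapping.keys (terms_such_that P f) = {k \<in> Poly_Mapping.keys f. P k}"
  by (auto simp: in_keys_iff lookup_terms_such_that split: if_splits)

text \<open>
  Every polynomial is a sum of terms, so closure under multiplication by a single term is enough;
  negation is multiplication by the constant $-1$.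
\<close>
lemma ideal_mpoly_ringI:
  fixes W :: "'k::field mpoly set"
  assumes carrier: "W \<subseteq> carrier (mpoly_ring n)" and zero: "0 \<in> W"
    and add: "\<And>f g. f \<in> W \<Longrightarrow> g \<in> W \<Longrightarrow> f + g \<in> W"
    and mult: "\<And>b c g. b \<in> monomials n \<Longrightarrow> g \<in> W \<Longrightarrow> Poly_Mapping.single b c * g \<in> W"
  shows "ideal W (mpoly_ring n)"
proof -
  interpret cring "mpoly_ring n :: 'k mpoly ring" by (rule cring_mpoly_ring)
  have closed: "x * f \<in> W" if "f \<in> W" "x \<in> carrier (mpoly_ring n)" for x f
  proof -
    have "(\<Sum>k\<in>K. Poly_Mapping.single k (Poly_Mapping.lookup x k) * f) \<in> W"
      if "finite K" "K \<subseteq> Poly_Mapping.keys x" for K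
      using that
    proof induction
      case (insert k K)
      then have "k \<in> monomials n" using \<open>x \<in> carrier _\<close> by auto
      with insert show ?case using \<open>f \<in> W\<close> by (auto intro!: add mult)
    qed (simp add: zero)
    then show ?thesis
      by (subst mpoly_eq_sum_of_terms) (simp add: sum_distrib_right)
  qed
  have neg: "\<ominus>\<^bsub>mpoly_ring n\<^esub> f \<in> W" if "f \<in> W" for f
  proof -
    have "- f \<in> W"
      using mult[of 0 f "-1"] that by (simp add: single_uminus)
    moreover from this that have "- f \<in> carrier (mpoly_ring n)" "f \<in> carrier (mpoly_ring n)"
      using carrier by blast+
    then have "\<ominus>\<^bsub>mpoly_ring n\<^esub> f = - f"
      by (intro minus_equality) simp_all
    ultimately show ?thesis by simp
  qed
  show ?thesis
  proof (rule idealI)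
    show "subgroup W (add_monoid (mpoly_ring n))"
      using carrier zero add neg by unfold_locales (auto simp: a_inv_def)
    show "a \<otimes>\<^bsub>mpoly_ring n\<^esub> x \<in> W" if "a \<in> W" "x \<in> carrier (mpoly_ring n)" for a x
      using closed[OF that] by (simp add: mult.commute)
  qed (use closed ring_mpoly_ring in auto)
qed

lemma
  assumes "ideal J (mpoly_ring n :: 'k::field mpoly ring)"
  shows ideal_mpoly_zero: "0 \<in> J"
    and ideal_mpoly_add: "f \<in> J \<Longrightarrow> g \<in> J \<Longrightarrow> f + g \<in> J"
    and ideal_mpoly_single_times: "b \<in> monomials n \<Longrightarrow> f \<in> J \<Longrightarrow> Poly_Mapping.single b c * f \<in> J"
    and ideal_mpoly_keys: "f \<in> J \<Longrightarrow> Poly_Mapping.keys f \<subseteq> monomials n"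
proof -
  interpret ideal J "mpoly_ring n" by fact
  show "0 \<in> J" using additive_subgroup.zero_closed[OF is_additive_subgroup] by simp
  show "f \<in> J \<Longrightarrow> g \<in> J \<Longrightarrow> f + g \<in> J" 
    using additive_subgroup.a_closed[OF is_additive_subgroup, of f g] by simp
  show "Poly_Mapping.single b c * f \<in> J" if "b \<in> monomials n" "f \<in> J"
    using I_l_closed[of f "Poly_Mapping.single b c"] that by simp
  show "f \<in> J \<Longrightarrow> Poly_Mapping.keys f \<subseteq> monomials n" using subsetD[OF a_subset, of f] by simp
qed

lemma ideal_zero_mpoly: "ideal {0} (mpoly_ring n :: 'k::field mpoly ring)"
  by (rule ideal_mpoly_ringI) auto

section \<open>Monomial ideals\<close>

lemma monomial_polys_in_carrier:
  "M \<subseteq> monomials n \<Longrightarrow> monomial_poly ` M \<subseteq> carrier (mpoly_ring n)"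
  by (auto simp: monomial_poly_def)

text \<open>
  The polynomials on the right form an ideal containing the generators; conversely each of their
  terms is a multiple of a generator.
\<close>
lemma in_Idl_monomials_iff:
  assumes M: "M \<subseteq> monomials n"
  shows "(f :: 'k::field mpoly) \<in> Idl\<^bsub>mpoly_ring n\<^esub> (monomial_poly ` M) \<longleftrightarrow>
    Poly_Mapping.keys f \<subseteq> monomials n \<and> (\<forall>k\<in>Poly_Mapping.keys f. \<exists>m\<in>M. monomial_dvd m k)"
    (is "f \<in> ?J \<longleftrightarrow> _")
proof -
  define W :: "'k mpoly set" where "W = {f. Poly_Mapping.keys f \<subseteq> monomials n \<and>
    (\<forall>k\<in>Poly_Mapping.keys f. \<exists>m\<in>M. monomial_dvd m k)}"
  note car = monomial_polys_in_carrier[OF M]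
  have idealJ: "ideal ?J (mpoly_ring n)"
    by (intro ring.genideal_ideal ring_mpoly_ring car)
  have "ideal W (mpoly_ring n)"
  proof (rule ideal_mpoly_ringI)
    fix f g assume "f \<in> W" "g \<in> W"
    then show "f + g \<in> W"
      using Poly_Mapping.keys_add[of f g] unfolding W_def by blast
  next
    fix b c g assume b: "b \<in> monomials n" and g: "g \<in> W"
    have "\<exists>m\<in>M. monomial_dvd m (b + k)" if "k \<in> Poly_Mapping.keys g" for k
      using that g monomial_dvd_trans monomial_dvd_add(2) unfolding W_def by blast
    then show "Poly_Mapping.single b c * g \<in> W"
      using b g by (auto simp: W_def keys_single_times add_in_monomials)
  qed (auto simp: W_def)
  moreover have "monomial_poly ` M \<subseteq> W"
    using M by (fastforce simp: W_def monomial_poly_def intro: monomial_dvd_refl)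
  ultimately have "?J \<subseteq> W" by (intro ring.genideal_minimal ring_mpoly_ring)
  moreover have "f \<in> ?J" if "f \<in> W" for f
  proof -
    have single: "Poly_Mapping.single k (Poly_Mapping.lookup f k) \<in> ?J"
      if k: "k \<in> Poly_Mapping.keys f" for k
    proof -
      obtain m where m: "m \<in> M" "monomial_dvd m k"
        using k \<open>f \<in> W\<close> by (auto simp: W_def)
      then obtain d where d: "k = m + d" by (elim monomial_dvdE)
      have "d \<in> monomials n"
        using k d \<open>f \<in> W\<close> by (auto simp: W_def add_in_monomials)
      moreover have "monomial_poly m \<in> ?J"
        using ring.genideal_self[OF ring_mpoly_ring car] m(1) by blast
      ultimately have "Poly_Mapping.single d (Poly_Mapping.lookup f k) * monomial_poly m \<in> ?J"
        by (rule ideal_mpoly_single_times[OF idealJ])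
      then show ?thesis by (simp add: monomial_poly_def mult_single d add.commute)
    qed
    have "(\<Sum>k\<in>K. Poly_Mapping.single k (Poly_Mapping.lookup f k)) \<in> ?J"
      if "finite K" "K \<subseteq> Poly_Mapping.keys f" for K
      using that
      by induction (auto intro!: ideal_mpoly_add[OF idealJ] ideal_mpoly_zero[OF idealJ] single)
    then show ?thesis by (subst mpoly_eq_sum_of_terms) simp
  qed
  ultimately have "?J = W" by blast
  then show ?thesis by (simp add: W_def)
qed

lemma monomial_poly_in_Idl_monomials_iff:
  assumes "M \<subseteq> monomials n"
  shows "(monomial_poly b :: 'k::field mpoly) \<in> Idl\<^bsub>mpoly_ring n\<^esub> (monomial_poly ` M) \<longleftrightarrow>
    b \<in> monomials n \<and> (\<exists>m\<in>M. monomial_dvd m b)"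
  unfolding in_Idl_monomials_iff[OF assms] by (simp add: monomial_poly_def)

lemma monomial_ideal_contains_monomials:
  assumes "monomial_ideal n J" "f \<in> J" "k \<in> Poly_Mapping.keys f"
  shows "monomial_poly k \<in> J"
proof -
  obtain M where M: "M \<subseteq> monomials n" "J = Idl\<^bsub>mpoly_ring n\<^esub> (monomial_poly ` M)"
    using assms(1) by (auto simp: monomial_ideal_def)
  have "k \<in> monomials n \<and> (\<exists>m\<in>M. monomial_dvd m k)"
    using assms(2,3) unfolding M(2) in_Idl_monomials_iff[OF M(1)] by blast
  then show ?thesis
    unfolding M(2) monomial_poly_in_Idl_monomials_iff[OF M(1)] .
qed

lemma monomial_ideal_upward_closed:
  assumes "monomial_ideal n J" "monomial_poly m \<in> J" "monomial_dvd m k" "k \<in> monomials n"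
  shows "monomial_poly k \<in> J"
proof -
  obtain M where M: "M \<subseteq> monomials n" "J = Idl\<^bsub>mpoly_ring n\<^esub> (monomial_poly ` M)"
    using assms(1) by (auto simp: monomial_ideal_def)
  show ?thesis
    using assms(2-) monomial_dvd_trans
    unfolding M(2) monomial_poly_in_Idl_monomials_iff[OF M(1)] by blast
qed

text \<open>
  A nonzero monomial ideal has a minimal generator, so the maximum defining \<^const>\<open>delta\<close> is taken over a
  nonempty set.
\<close>
lemma delta_Idl_monomials_le:
  fixes M :: "monomial set" and n D :: nat
  defines "J \<equiv> (Idl\<^bsub>mpoly_ring n\<^esub> (monomial_poly ` M) :: 'k::field mpoly set)"
  assumes M: "M \<subseteq> monomials n"
    and bound: "\<And>b. b \<in> minimal_monomial_generators n J \<Longrightarrow> weight (\<lambda>_. 1) b \<le> D"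
  shows "delta n J \<le> D"
proof (cases "J = {0}")
  case False
  have "M \<noteq> {}"
  proof
    assume "M = {}"
    then have "f \<in> J \<longleftrightarrow> f = 0" for f
      unfolding J_def in_Idl_monomials_iff[OF M] by auto
    with False show False by blast
  qed
  then obtain b where "b \<in> monomials n" "monomial_poly b \<in> J"
    using M monomial_dvd_refl unfolding J_def monomial_poly_in_Idl_monomials_iff[OF M] by blast
  then obtain m where "m \<in> minimal_monomial_generators n J"
    by (rule obtain_minimal_monomial_generator)
  then have "Max (weight (\<lambda>_. 1) ` minimal_monomial_generators n J) \<le> D"
    using bound by (intro Max.boundedI) (auto simp: finite_minimal_monomial_generators)
  with False show ?thesis by (simp add: delta_def)
qed (simp add: delta_def)

definition monomial_radical :: "monomial \<Rightarrow> monomial" where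
  "monomial_radical b = (\<Sum>i\<in>Poly_Mapping.keys b. Poly_Mapping.single i 1)"

lemma lookup_monomial_radical:
  "Poly_Mapping.lookup (monomial_radical b) i = (if i \<in> Poly_Mapping.keys b then 1 else 0)"
  by (simp add: monomial_radical_def lookup_sum lookup_single when_def)

lemma keys_monomial_radical [simp]: "Poly_Mapping.keys (monomial_radical b) = Poly_Mapping.keys b"
  by (auto simp: in_keys_iff[of _ "monomial_radical b"] lookup_monomial_radical split: if_splits)

lemma monomial_radical_dvd: "monomial_dvd (monomial_radical b) b"
  by (auto simp: monomial_dvd_def lookup_monomial_radical in_keys_iff Suc_le_eq)

lemma monomial_radical_in_monomials [simp]: "monomial_radical b \<in> monomials n \<longleftrightarrow> b \<in> monomials n"
  by (simp add: monomials_def)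

lemma squarefree_dvd_radical:
  assumes "\<forall>i. Poly_Mapping.lookup m i \<le> 1" "monomial_dvd m b"
  shows "monomial_dvd m (monomial_radical b)"
  unfolding monomial_dvd_def
proof
  fix i
  show "Poly_Mapping.lookup m i \<le> Poly_Mapping.lookup (monomial_radical b) i"
    using assms by (cases "Poly_Mapping.lookup b i = 0")
      (auto simp: monomial_dvd_def lookup_monomial_radical in_keys_iff dest: spec[of _ i])
qed

lemma squarefree_monomial_ideal_generator:
  assumes "squarefree_monomial_ideal n J" "monomial_poly b \<in> J"
  obtains m where "monomial_poly m \<in> J" "\<forall>i. Poly_Mapping.lookup m i \<le> 1" "monomial_dvd m b"
proof -
  obtain M where M: "M \<subseteq> {a \<in> monomials n. \<forall>i. Poly_Mapping.lookup a i \<le> 1}"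
      "J = Idl\<^bsub>mpoly_ring n\<^esub> (monomial_poly ` M)"
    using assms(1) by (auto simp: squarefree_monomial_ideal_def)
  then have Mn: "M \<subseteq> monomials n" by blast
  obtain m where m: "m \<in> M" "monomial_dvd m b"
    using assms(2) unfolding M(2) monomial_poly_in_Idl_monomials_iff[OF Mn] by blast
  show ?thesis
  proof (rule that[of m])
    show "monomial_poly m \<in> J"
      using m(1) Mn monomial_dvd_refl unfolding M(2) monomial_poly_in_Idl_monomials_iff[OF Mn] by blast
  qed (use m M(1) in auto)
qed

text \<open>
  Every generator is a multiple of its radical, so the square-free members of the generating set
  generate the same ideal.
\<close>
lemma squarefree_Idl_of_radical_closed:
  assumes M: "M \<subseteq> monomials n" and radical: "\<And>b. b \<in> M \<Longrightarrow> monomial_radical b \<in> M"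
  shows "squarefree_monomial_ideal n (Idl\<^bsub>mpoly_ring n\<^esub> (monomial_poly ` M) :: 'k::field mpoly set)"
proof -
  let ?N = "{b \<in> M. \<forall>i. Poly_Mapping.lookup b i \<le> 1}"
  have N: "?N \<subseteq> monomials n" using M by blast
  have same_multiples: "(\<exists>m\<in>M. monomial_dvd m k) \<longleftrightarrow> (\<exists>m\<in>?N. monomial_dvd m k)" for k
  proof
    assume "\<exists>m\<in>M. monomial_dvd m k"
    then obtain m where "m \<in> M" "monomial_dvd m k" by blast
    then show "\<exists>m\<in>?N. monomial_dvd m k"
      using radical monomial_dvd_trans[OF monomial_radical_dvd]
      by (intro bexI[of _ "monomial_radical m"]) (auto simp: lookup_monomial_radical)
  qed blast
  have "Idl\<^bsub>mpoly_ring n\<^esub> (monomial_poly ` M) = (Idl\<^bsub>mpoly_ring n\<^esub> (monomial_poly ` ?N) :: 'k mpoly set)"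
    by (intro Set.set_eqI) (simp only: in_Idl_monomials_iff[OF M] in_Idl_monomials_iff[OF N] same_multiples)
  then show ?thesis
    unfolding squarefree_monomial_ideal_def using N by blast
qed

section \<open>The monomial map\<close>

text \<open>
  The monomial map sends the monomial with exponent vector \<open>b\<close> to the one with exponent vector
  \<open>exponent_map a b\<close>. The factor \<open>of_nat n\<close> is a constant of the convolution semiring in which exponent
  vectors live here, and multiplication by it is the $n$-fold sum.
\<close>
definition exponent_map :: "(nat \<Rightarrow> monomial) \<Rightarrow> monomial \<Rightarrow> monomial" where
  "exponent_map a b = (\<Sum>i\<in>Poly_Mapping.keys b. of_nat (Poly_Mapping.lookup b i) * a i)"

lemma exponent_map_zero [simp]: "exponent_map a 0 = 0"
  by (simp add: exponent_map_def)

lemma exponent_map_add: "exponent_map a (b + c) = exponent_map a b + exponent_map a c"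
  unfolding exponent_map_def
  by (rule setsum_keys_plus_distrib[where f = "\<lambda>i n. of_nat n * a i"]) (simp_all add: algebra_simps)

lemma exponent_map_variable [simp]: "exponent_map a (Poly_Mapping.single i (Suc 0)) = a i"
  by (simp add: exponent_map_def)

lemma lookup_of_nat_times:
  "Poly_Mapping.lookup (of_nat n * x) j = n * Poly_Mapping.lookup x j" for x :: monomial
  by (induction n) (simp_all add: lookup_add algebra_simps)

lemma lookup_exponent_map:
  "Poly_Mapping.lookup (exponent_map a b) j =
     (\<Sum>i\<in>Poly_Mapping.keys b. Poly_Mapping.lookup b i * Poly_Mapping.lookup (a i) j)"
  by (simp add: exponent_map_def lookup_sum lookup_of_nat_times)

lemma lookup_exponent_map_neq_0_iff:
  "Poly_Mapping.lookup (exponent_map a b) j \<noteq> 0 \<longleftrightarrow>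
     (\<exists>i\<in>Poly_Mapping.keys b. Poly_Mapping.lookup (a i) j \<noteq> 0)"
  by (auto simp: lookup_exponent_map in_keys_iff)

lemma weight_of_nat_times: "weight w (of_nat n * x) = n * weight w x"
  by (induction n) (simp_all add: weight_add algebra_simps)

text \<open>
  The weight order on the source is thus the pullback of the weight on the target: monomials with
  the same image have the same weight.
\<close>
lemma weight_exponent_map: "weight w (exponent_map a b) = weight (\<lambda>i. weight w (a i)) b"
proof -
  have "weight w (sum x K) = (\<Sum>i\<in>K. weight w (x i))" for x and K :: "nat set"
    by (induction K rule: infinite_finite_induct) (simp_all add: weight_add)
  then have "weight w (exponent_map a b) =
      (\<Sum>i\<in>Poly_Mapping.keys b. Poly_Mapping.lookup b i * weight w (a i))"
    by (simp add: exponent_map_def weight_of_nat_times)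
  then show ?thesis
    by (simp add: weight_def[of "\<lambda>i. weight w (a i)"] mult.commute)
qed

lemma exponent_map_in_subsemigroup:
  assumes T: "subsemigroup T" and gens: "a ` {..<r} \<subseteq> T" and b: "b \<in> monomials r"
  shows "exponent_map a b \<in> T"
proof -
  have zero: "0 \<in> T" and add: "\<And>x y. x \<in> T \<Longrightarrow> y \<in> T \<Longrightarrow> x + y \<in> T"
    using T by (auto simp: subsemigroup_def)
  have mult: "of_nat n * x \<in> T" if "x \<in> T" for n x
    by (induction n) (auto simp: algebra_simps intro!: zero add that)
  have "(\<Sum>i\<in>K. of_nat (Poly_Mapping.lookup b i) * a i) \<in> T" if "finite K" "K \<subseteq> {..<r}" for K
    using that gens by induction (auto intro!: zero add mult)
  then show ?thesis using b by (simp add: exponent_map_def monomials_def)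
qed

lemma subsemigroup_hull_eq_image_exponent_map:
  "subsemigroup hull (a ` {..<r}) = exponent_map a ` monomials r"
proof (rule hull_unique)
  show "a ` {..<r} \<subseteq> exponent_map a ` monomials r"
  proof
    fix x assume "x \<in> a ` {..<r}"
    then obtain i where "i < r" "x = a i" by auto
    then show "x \<in> exponent_map a ` monomials r"
      by (intro image_eqI[of _ _ "Poly_Mapping.single i 1"]) (auto simp: monomials_def)
  qed
  show "subsemigroup (exponent_map a ` monomials r)"
    unfolding subsemigroup_def
  proof (intro conjI ballI)
    show "0 \<in> exponent_map a ` monomials r"
      by (rule image_eqI[of _ _ 0]) simp_all
    fix x y assume "x \<in> exponent_map a ` monomials r" "y \<in> exponent_map a ` monomials r"
    then obtain b c where "b \<in> monomials r" "c \<in> monomials r" "x = exponent_map a b" "y = exponent_map a c"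
      by blast
    then show "x + y \<in> exponent_map a ` monomials r"
      by (intro image_eqI[of _ _ "b + c"]) (simp_all add: exponent_map_add add_in_monomials)
  qed
  show "exponent_map a ` monomials r \<subseteq> T" if "a ` {..<r} \<subseteq> T" "subsemigroup T" for T
    using exponent_map_in_subsemigroup that by blast
qed

lemma subsemigroup_monomials: "subsemigroup (monomials n)"
  by (simp add: subsemigroup_def add_in_monomials)

lemma monomial_poly_power: "monomial_poly x ^ n = (Poly_Mapping.single (of_nat n * x) 1 :: 'k::field mpoly)"
  by (induction n) (simp_all add: monomial_poly_def mult_single algebra_simps)

lemma prod_single_one:
  "finite K \<Longrightarrow> (\<Prod>i\<in>K. Poly_Mapping.single (x i) 1) = (Poly_Mapping.single (\<Sum>i\<in>K. x i) 1 :: 'k::field mpoly)"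
  by (induction K rule: finite_induct) (simp_all add: mult_single)

lemma monomial_map_eq_sum:
  "monomial_map a f =
     (\<Sum>b\<in>Poly_Mapping.keys f. Poly_Mapping.single (exponent_map a b) (Poly_Mapping.lookup f b))"
  unfolding monomial_map_def substitute_def
  by (intro sum.cong refl)
    (simp add: monomial_poly_power prod_single_one mult_single exponent_map_def)

lemma monomial_map_zero [simp]: "monomial_map a 0 = 0"
  by (simp add: monomial_map_eq_sum)

lemma monomial_map_add: "monomial_map a (f + g) = monomial_map a f + monomial_map a g"
  unfolding monomial_map_eq_sum
  by (rule setsum_keys_plus_distrib[where f = "\<lambda>b. Poly_Mapping.single (exponent_map a b)"])
    (simp_all add: single_add)

lemma monomial_map_single: "monomial_map a (Poly_Mapping.single b c) = Poly_Mapping.single (exponent_map a b) c"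
  by (simp add: monomial_map_eq_sum)

lemma monomial_map_single_times:
  "monomial_map a (Poly_Mapping.single b c * f) = Poly_Mapping.single (exponent_map a b) c * monomial_map a f"
proof (cases "c = 0")
  case False
  then show ?thesis
    by (simp add: monomial_map_eq_sum keys_single_times sum.reindex sum_distrib_left
      lookup_single_times_add exponent_map_add mult_single)
qed simp

lemma lookup_monomial_map:
  "Poly_Mapping.lookup (monomial_map a f) c =
     (\<Sum>b\<in>{b \<in> Poly_Mapping.keys f. exponent_map a b = c}. Poly_Mapping.lookup f b)"
  by (simp add: monomial_map_eq_sum lookup_sum lookup_single when_def sum.inter_filter)

lemma in_keys_monomial_map:
  assumes "c \<in> Poly_Mapping.keys (monomial_map a f)"
  obtains b where "b \<in> Poly_Mapping.keys f" "c = exponent_map a b"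
proof -
  have "{b \<in> Poly_Mapping.keys f. exponent_map a b = c} \<noteq> {}"
    using assms unfolding in_keys_iff lookup_monomial_map by (metis sum.empty)
  then show ?thesis using that by blast
qed

text \<open>
  Keeping only the terms over one target monomial keeps exactly that term of the image. If the
  coefficient there cancels, the kept part lies in the toric ideal.
\<close>
lemma monomial_map_fiber_part:
  "monomial_map a (terms_such_that (\<lambda>c. exponent_map a c = e) f) =
     Poly_Mapping.single e (Poly_Mapping.lookup (monomial_map a f) e)"
proof (rule poly_mapping_eqI)
  fix k
  have "{b \<in> {c \<in> Poly_Mapping.keys f. exponent_map a c = e}. exponent_map a b = k} =
      (if k = e then {b \<in> Poly_Mapping.keys f. exponent_map a b = e} else {})"
    by auto
  then show "Poly_Mapping.lookup (monomial_map a (terms_such_that (\<lambda>c. exponent_map a c = e) f)) k =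
      Poly_Mapping.lookup (Poly_Mapping.single e (Poly_Mapping.lookup (monomial_map a f) e)) k"
    by (simp add: lookup_monomial_map keys_terms_such_that lookup_terms_such_that lookup_single)
qed

text \<open>
  Choosing one preimage for every monomial of \<open>h\<close>, and \<open>b\<close> for its own image, lifts \<open>h\<close> term by term.
\<close>
lemma monomial_map_lifting:
  assumes h: "Poly_Mapping.keys h \<subseteq> exponent_map a ` monomials r"
    and b: "b \<in> monomials r"
  obtains f where "f \<in> carrier (mpoly_ring r)" "monomial_map a f = h"
    "Poly_Mapping.lookup f b = Poly_Mapping.lookup h (exponent_map a b)"
    "\<forall>c\<in>Poly_Mapping.keys f. exponent_map a c \<in> Poly_Mapping.keys h"
    "\<forall>c\<in>Poly_Mapping.keys f. exponent_map a c = exponent_map a b \<longrightarrow> c = b"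
proof -
  have "\<exists>\<sigma>. \<forall>c\<in>Poly_Mapping.keys h. \<sigma> c \<in> monomials r \<and> exponent_map a (\<sigma> c) = c \<and>
      (c = exponent_map a b \<longrightarrow> \<sigma> c = b)"
  proof (intro bchoice ballI)
    fix c assume "c \<in> Poly_Mapping.keys h"
    with h obtain b' where "b' \<in> monomials r" "c = exponent_map a b'" by blast
    then show "\<exists>b'. b' \<in> monomials r \<and> exponent_map a b' = c \<and> (c = exponent_map a b \<longrightarrow> b' = b)"
      using b by (cases "c = exponent_map a b") auto
  qed
  then obtain \<sigma> where \<sigma>: "\<And>c. c \<in> Poly_Mapping.keys h \<Longrightarrow>
      \<sigma> c \<in> monomials r \<and> exponent_map a (\<sigma> c) = c \<and> (c = exponent_map a b \<longrightarrow> \<sigma> c = b)"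
    by blast
  define f where "f = (\<Sum>c\<in>Poly_Mapping.keys h. Poly_Mapping.single (\<sigma> c) (Poly_Mapping.lookup h c))"
  have keys_f: "\<exists>c\<in>Poly_Mapping.keys h. k = \<sigma> c" if "k \<in> Poly_Mapping.keys f" for k
  proof (rule ccontr)
    assume "\<not> ?thesis"
    then have "Poly_Mapping.lookup f k = 0"
      by (auto simp: f_def lookup_sum lookup_single when_def intro!: sum.neutral)
    with that show False by (simp add: in_keys_iff)
  qed
  have "monomial_map a (\<Sum>c\<in>K. g c) = (\<Sum>c\<in>K. monomial_map a (g c))" if "finite K"
    for K and g :: "monomial \<Rightarrow> 'a mpoly"
    using that by induction (simp_all add: monomial_map_add)
  then have "monomial_map a f = (\<Sum>c\<in>Poly_Mapping.keys h. Poly_Mapping.single c (Poly_Mapping.lookup h c))"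
    using \<sigma> by (simp add: f_def monomial_map_single)
  then have map: "monomial_map a f = h" by (simp add: mpoly_eq_sum_of_terms[symmetric])
  have fiber: "c = b" if "c \<in> Poly_Mapping.keys f" "exponent_map a c = exponent_map a b" for c
    using keys_f[OF that(1)] that(2) \<sigma> by auto
  show ?thesis
  proof (rule that[of f])
    show "f \<in> carrier (mpoly_ring r)" using keys_f \<sigma> by auto
    show "Poly_Mapping.lookup f b = Poly_Mapping.lookup h (exponent_map a b)"
    proof -
      have "{c \<in> Poly_Mapping.keys f. exponent_map a c = exponent_map a b} =
          (if b \<in> Poly_Mapping.keys f then {b} else {})"
        using fiber by auto
      then show ?thesis
        unfolding map[symmetric] lookup_monomial_map by (simp add: in_keys_iff)
    qed
    show "\<forall>c\<in>Poly_Mapping.keys f. exponent_map a c \<in> Poly_Mapping.keys h"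
      using keys_f \<sigma> by fastforce
  qed (use map fiber in auto)
qed

lemma ideal_contraction:
  assumes a: "a ` {..<r} \<subseteq> monomials s" and I: "ideal I (mpoly_ring s)"
  shows "ideal (contraction r a I) (mpoly_ring r)"
proof (rule ideal_mpoly_ringI)
  fix f g assume "f \<in> contraction r a I" "g \<in> contraction r a I"
  then show "f + g \<in> contraction r a I"
    using Poly_Mapping.keys_add[of f g] ideal_mpoly_add[OF I]
    by (auto simp: contraction_def monomial_map_add)
next
  fix b c g assume b: "b \<in> monomials r" and g: "g \<in> contraction r a I"
  from b have "exponent_map a b \<in> monomials s"
    by (intro exponent_map_in_subsemigroup[OF subsemigroup_monomials a])
  then show "Poly_Mapping.single b c * g \<in> contraction r a I"
    using b g by (auto simp: contraction_def monomial_map_single_times keys_single_times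
      add_in_monomials ideal_mpoly_zero[OF I] intro!: ideal_mpoly_single_times[OF I])
qed (auto simp: contraction_def ideal_mpoly_zero[OF I])

lemma toric_ideal_eq_contraction: "toric_ideal r s a = contraction r a {0}"
  by (simp add: toric_ideal_def a_kernel_def' contraction_def)

section \<open>Initial ideals\<close>

definition leading_monomials :: "(monomial \<Rightarrow> monomial \<Rightarrow> bool) \<Rightarrow> 'k::field mpoly set \<Rightarrow> monomial set" where
  "leading_monomials lt J = {b. \<exists>f\<in>J. is_leading_monomial lt f b}"

lemma leading_monomials_subset:
  "ideal J (mpoly_ring n) \<Longrightarrow> leading_monomials lt J \<subseteq> monomials n"
  using ideal_mpoly_keys by (auto simp: leading_monomials_def is_leading_monomial_def)

lemma initial_ideal_eq: "initial_ideal n lt J = Idl\<^bsub>mpoly_ring n\<^esub> (monomial_poly ` leading_monomials lt J)"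
  by (simp add: initial_ideal_def leading_monomials_def setcompr_eq_image)

lemma monomial_ideal_initial_ideal:
  "ideal J (mpoly_ring n) \<Longrightarrow> monomial_ideal n (initial_ideal n lt J)"
  unfolding initial_ideal_eq monomial_ideal_def using leading_monomials_subset by blast

text \<open>
  A multiple of a leading monomial is again one: multiply the polynomial by the cofactor and use that
  the order is compatible with multiplication.
\<close>
lemma monomial_poly_in_initial_ideal_iff:
  fixes J :: "'k::field mpoly set"
  assumes J: "ideal J (mpoly_ring n)" and lt: "term_order n lt"
  shows "monomial_poly b \<in> initial_ideal n lt J \<longleftrightarrow> b \<in> leading_monomials lt J"
proof -
  have "b + c \<in> leading_monomials lt J" if "b \<in> leading_monomials lt J" "c \<in> monomials n" for b c
  proof -
    from that obtain f where f: "f \<in> J" "is_leading_monomial lt f b"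
      by (auto simp: leading_monomials_def)
    have keys: "Poly_Mapping.keys f \<subseteq> monomials n" using ideal_mpoly_keys[OF J f(1)] .
    have "is_leading_monomial lt (Poly_Mapping.single c 1 * f) (b + c)"
      unfolding is_leading_monomial_def
    proof (intro conjI ballI impI)
      show "b + c \<in> Poly_Mapping.keys (Poly_Mapping.single c 1 * f)"
        using f(2) by (simp add: keys_single_times is_leading_monomial_def add.commute[of b])
      fix k assume "k \<in> Poly_Mapping.keys (Poly_Mapping.single c 1 * f)" "k \<noteq> b + c"
      then obtain k' where "k = k' + c" "k' \<in> Poly_Mapping.keys f" "k' \<noteq> b"
        by (auto simp: keys_single_times add.commute)
      moreover from this have "lt k' b" using f(2) by (simp add: is_leading_monomial_def)
      moreover have "b \<in> monomials n" using f(2) keys by (auto simp: is_leading_monomial_def)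
      ultimately show "lt k (b + c)"
        using keys that(2) lt unfolding term_order_def by blast
    qed
    moreover have "Poly_Mapping.single c 1 * f \<in> J"
      by (intro ideal_mpoly_single_times[OF J] that f)
    ultimately show ?thesis by (auto simp: leading_monomials_def)
  qed
  then have "b \<in> leading_monomials lt J"
    if "b \<in> monomials n" "m \<in> leading_monomials lt J" "monomial_dvd m b" for m
    using that by (metis monomial_dvdE add_in_monomials)
  then show ?thesis
    using leading_monomials_subset[OF J, of lt] monomial_dvd_refl
    unfolding initial_ideal_eq monomial_poly_in_Idl_monomials_iff[OF leading_monomials_subset[OF J]]
    by blast
qed

lemma term_order_weight_order:
  assumes "term_order n lt"
  shows "term_order n (weight_order w lt)"
proof -
  have irrefl: "irreflp_on (monomials n) lt" and trans: "transp_on (monomials n) lt"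
    and total: "totalp_on (monomials n) lt"
    and zero: "\<And>a. a \<in> monomials n \<Longrightarrow> a \<noteq> 0 \<Longrightarrow> lt 0 a"
    and add: "\<And>a b c. a \<in> monomials n \<Longrightarrow> b \<in> monomials n \<Longrightarrow> c \<in> monomials n \<Longrightarrow>
      lt a b \<Longrightarrow> lt (a + c) (b + c)"
    using assms by (simp_all add: term_order_def)
  show ?thesis
    unfolding term_order_def
  proof (intro conjI ballI impI)
    show "irreflp_on (monomials n) (weight_order w lt)"
      using irreflp_onD[OF irrefl] by (intro irreflp_onI) (simp add: weight_order_def)
    show "transp_on (monomials n) (weight_order w lt)"
    proof (rule transp_onI)
      fix a b c assume "a \<in> monomials n" "b \<in> monomials n" "c \<in> monomials n"
        and "weight_order w lt a b" "weight_order w lt b c"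
      then show "weight_order w lt a c"
        using transp_onD[OF trans, of a b c] unfolding weight_order_def by (elim disjE) simp_all
    qed
    show "totalp_on (monomials n) (weight_order w lt)"
      using totalp_onD[OF total] by (intro totalp_onI) (auto simp: weight_order_def)
  next
    fix a assume "a \<in> monomials n" "a \<noteq> 0"
    then show "weight_order w lt 0 a" using zero by (auto simp: weight_order_def)
  next
    fix a b c assume "a \<in> monomials n" "b \<in> monomials n" "c \<in> monomials n" "weight_order w lt a b"
    then show "weight_order w lt (a + c) (b + c)"
      using add[of a b c] by (auto simp: weight_order_def weight_add)
  qed
qed

lemma initial_form_in_carrier:
  "ideal I (mpoly_ring n) \<Longrightarrow> initial_form w ` I \<subseteq> carrier (mpoly_ring n)"
  using ideal_mpoly_keys by (fastforce simp: initial_form_def keys_terms_such_that)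

lemma initial_form_in_weight_initial_ideal:
  assumes "ideal I (mpoly_ring n)" "f \<in> I"
  shows "initial_form w f \<in> weight_initial_ideal n w I"
  unfolding weight_initial_ideal_def
  using ring.genideal_self[OF ring_mpoly_ring initial_form_in_carrier[OF assms(1)]] assms(2) by blast

text \<open>
  The component of weight \<open>d\<close> of any element of the initial ideal is the top component of an element
  of \<open>I\<close>, or zero. The elements with this property for all \<open>d\<close> form an ideal: multiplying by a term
  shifts weights, and adding two lifts of the same weight adds their components, even when these
  cancel. In particular a monomial in the initial ideal is the initial form of an element of \<open>I\<close>.
\<close>
lemma weight_initial_ideal_component_lifts:
  assumes I: "ideal I (mpoly_ring n)" and g: "g \<in> weight_initial_ideal n w I"
  obtains h where "h \<in> I" "\<forall>k\<in>Poly_Mapping.keys h. weight w k \<le> d"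
    "\<forall>k. weight w k = d \<longrightarrow> Poly_Mapping.lookup h k = Poly_Mapping.lookup g k"
proof -
  define lifts where "lifts d g h \<longleftrightarrow> h \<in> I \<and> (\<forall>k\<in>Poly_Mapping.keys h. weight w k \<le> d) \<and>
    (\<forall>k. weight w k = d \<longrightarrow> Poly_Mapping.lookup h k = Poly_Mapping.lookup g k)" for d g h
  define W where "W = {g \<in> carrier (mpoly_ring n). \<forall>d. \<exists>h. lifts d g h}"
  have "ideal W (mpoly_ring n)"
  proof (rule ideal_mpoly_ringI)
    have "lifts d 0 0" for d
      by (simp add: lifts_def ideal_mpoly_zero[OF I])
    then show "0 \<in> W" by (auto simp: W_def)
  next
    fix f g assume fg: "f \<in> W" "g \<in> W"
    have "\<exists>h. lifts d (f + g) h" for d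
    proof -
      obtain h h' where "lifts d f h" "lifts d g h'" using fg unfolding W_def by blast
      then have "lifts d (f + g) (h + h')"
        using Poly_Mapping.keys_add[of h h']
        by (auto simp: lifts_def lookup_add intro!: ideal_mpoly_add[OF I])
      then show ?thesis ..
    qed
    then show "f + g \<in> W"
      using fg Poly_Mapping.keys_add[of f g] by (auto simp: W_def)
  next
    fix b c g assume b: "b \<in> monomials n" and g: "g \<in> W"
    have "\<exists>h. lifts d (Poly_Mapping.single b c * g) h" for d
    proof (cases "weight w b \<le> d")
      case True
      obtain h where h: "lifts (d - weight w b) g h" using g by (auto simp: W_def)
      \<comment> \<open>Multiplying by the term raises weights by that of \<open>b\<close>.\<close>
      have "lifts d (Poly_Mapping.single b c * g) (Poly_Mapping.single b c * h)"
        unfolding lifts_def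
      proof (intro conjI ballI allI impI)
        show "Poly_Mapping.single b c * h \<in> I"
          using h by (intro ideal_mpoly_single_times[OF I b]) (simp add: lifts_def)
      next
        fix k assume "k \<in> Poly_Mapping.keys (Poly_Mapping.single b c * h)"
        then obtain k' where "k = b + k'" "k' \<in> Poly_Mapping.keys h" by (rule in_keys_single_times)
        then show "weight w k \<le> d" using h True by (fastforce simp: lifts_def weight_add)
      next
        fix k assume k: "weight w k = d"
        show "Poly_Mapping.lookup (Poly_Mapping.single b c * h) k =
          Poly_Mapping.lookup (Poly_Mapping.single b c * g) k"
        proof (cases "\<exists>k'. k = b + k'")
          case True
          then obtain k' where k': "k = b + k'" ..
          with k have "weight w k' = d - weight w b" by (simp add: weight_add)
          with h show ?thesis by (simp add: k' lookup_single_times_add lifts_def)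
        next
          case False
          then show ?thesis by (metis in_keys_iff in_keys_single_times)
        qed
      qed
      then show ?thesis ..
    next
      case False
      \<comment> \<open>All monomials of the product weigh more than \<open>d\<close>.\<close>
      have "Poly_Mapping.lookup (Poly_Mapping.single b c * g) k = 0" if "weight w k = d" for k
      proof (rule ccontr)
        assume "Poly_Mapping.lookup (Poly_Mapping.single b c * g) k \<noteq> 0"
        then have "k \<in> Poly_Mapping.keys (Poly_Mapping.single b c * g)" by (simp add: in_keys_iff)
        then obtain k' where "k = b + k'" by (rule in_keys_single_times)
        with False that show False by (simp add: weight_add)
      qed
      then have "lifts d (Poly_Mapping.single b c * g) 0"
        by (simp add: lifts_def ideal_mpoly_zero[OF I])
      then show ?thesis ..
    qed
    then show "Poly_Mapping.single b c * g \<in> W"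
      using b g by (auto simp: W_def keys_single_times add_in_monomials)
  qed (auto simp: W_def)
  moreover have "initial_form w f \<in> W" if "f \<in> I" for f
  proof -
    have "\<exists>h. lifts d (initial_form w f) h" for d
    proof (cases "d = Max (weight w ` Poly_Mapping.keys f)")
      case True
      then have "lifts d (initial_form w f) f"
        using that by (auto simp: lifts_def initial_form_def lookup_terms_such_that)
      then show ?thesis ..
    next
      case False
      then have "lifts d (initial_form w f) 0"
        by (auto simp: lifts_def initial_form_def lookup_terms_such_that ideal_mpoly_zero[OF I])
      then show ?thesis ..
    qed
    then show ?thesis
      using initial_form_in_carrier[OF I, of w] that unfolding W_def by blast
  qed
  ultimately have "weight_initial_ideal n w I \<subseteq> W"
    unfolding weight_initial_ideal_def by (intro ring.genideal_minimal ring_mpoly_ring) auto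
  with g obtain h where "lifts d g h" unfolding W_def by blast
  then show ?thesis by (intro that[of h]) (auto simp: lifts_def)
qed

lemma top_monomial_in_weight_initial_ideal:
  assumes I: "ideal I (mpoly_ring n)" and mono: "monomial_ideal n (weight_initial_ideal n w I)"
    and f: "f \<in> I" "k \<in> Poly_Mapping.keys f" "\<And>c. c \<in> Poly_Mapping.keys f \<Longrightarrow> weight w c \<le> weight w k"
  shows "monomial_poly k \<in> weight_initial_ideal n w I"
proof -
  have "weight w k = Max (weight w ` Poly_Mapping.keys f)"
    using f by (intro Max_eqI[symmetric]) auto
  then have "k \<in> Poly_Mapping.keys (initial_form w f)"
    using f(2) by (simp add: initial_form_def keys_terms_such_that)
  then show ?thesis
    using monomial_ideal_contains_monomials[OF mono initial_form_in_weight_initial_ideal[OF I f(1)]] by blast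
qed

section \<open>The initial ideal of a contraction\<close>

text \<open>
  Let \<open>f\<close> in the contraction have leading monomial \<open>b\<close>. If the coefficient of the image of \<open>b\<close> in the image
  of \<open>f\<close> cancels, the terms of \<open>f\<close> over that monomial form an element of the toric ideal with
  leading monomial \<open>b\<close>. Otherwise the image of \<open>b\<close> occurs in the image of \<open>f\<close> with maximal weight, hence in
  an initial form.

  Conversely, a monomial $y^e$ of the initial ideal, $e$ being the image of \<open>b\<close>, is the initial form of
  some \<open>h\<close> in \<open>I\<close>. As \<open>I\<close> is graded, \<open>h\<close> can be cut down to the multidegree of $e$, and then
  all its monomials are in the image by the saturation hypothesis. A lift of \<open>h\<close> that chooses \<open>b\<close> over $e$
  has leading monomial \<open>b\<close>, because all its other terms have smaller weight.
\<close>
lemma leading_monomials_contraction_iff: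
  fixes I :: "'k::field mpoly set"
  assumes I: "ideal I (mpoly_ring s)"
    and mono: "monomial_ideal s (weight_initial_ideal s w I)"
    and comp: "\<And>f u. f \<in> I \<Longrightarrow> terms_such_that (\<lambda>c. multidegree v c = u) f \<in> I"
    and saturated: "\<And>b c. b \<in> monomials r \<Longrightarrow> c \<in> monomials s \<Longrightarrow>
      multidegree v c = multidegree v (exponent_map a b) \<Longrightarrow> c \<in> exponent_map a ` monomials r"
    and b: "b \<in> monomials r"
  shows "b \<in> leading_monomials (weight_order (\<lambda>i. weight w (a i)) lt) (contraction r a I) \<longleftrightarrow>
    b \<in> leading_monomials lt (toric_ideal r s a :: 'k mpoly set) \<or>
    monomial_poly (exponent_map a b) \<in> weight_initial_ideal s w I"
proof -
  let ?lt = "weight_order (\<lambda>i. weight w (a i)) lt"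
  let ?fiber = "\<lambda>f. terms_such_that (\<lambda>c. exponent_map a c = exponent_map a b) f"
  have lt_iff: "?lt c d \<longleftrightarrow> weight w (exponent_map a c) < weight w (exponent_map a d) \<or>
      (weight w (exponent_map a c) = weight w (exponent_map a d) \<and> lt c d)" for c d
    by (simp add: weight_order_def weight_exponent_map)
  \<comment> \<open>Over a single target monomial all weights agree, so there the weight order is \<open>lt\<close>.\<close>
  have fiber_leading: "is_leading_monomial ?lt (?fiber f) b \<longleftrightarrow> is_leading_monomial lt (?fiber f) b"
    for f :: "'k mpoly"
    by (auto simp: is_leading_monomial_def keys_terms_such_that lt_iff)
  have restrict: "is_leading_monomial lt' (?fiber f) b" if "is_leading_monomial lt' f b"
    for lt' and f :: "'k mpoly"
    using that by (auto simp: is_leading_monomial_def keys_terms_such_that)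
  show ?thesis
  proof
    assume "b \<in> leading_monomials ?lt (contraction r a I)"
    then obtain f where f: "f \<in> contraction r a I" "is_leading_monomial ?lt f b"
      by (auto simp: leading_monomials_def)
    show "b \<in> leading_monomials lt (toric_ideal r s a :: 'k mpoly set) \<or>
        monomial_poly (exponent_map a b) \<in> weight_initial_ideal s w I"
    proof (cases "Poly_Mapping.lookup (monomial_map a f) (exponent_map a b) = 0")
      case True
      then have "?fiber f \<in> toric_ideal r s a"
        using f(1)
        by (auto simp: toric_ideal_eq_contraction contraction_def monomial_map_fiber_part keys_terms_such_that)
      moreover have "is_leading_monomial lt (?fiber f) b"
        using restrict[OF f(2)] by (simp only: fiber_leading)
      ultimately show ?thesis by (auto simp: leading_monomials_def)
    next
      case False
      have "weight w c \<le> weight w (exponent_map a b)" if c: "c \<in> Poly_Mapping.keys (monomial_map a f)" for c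
      proof -
        obtain c' where "c' \<in> Poly_Mapping.keys f" "c = exponent_map a c'"
          using c by (rule in_keys_monomial_map)
        then show ?thesis
          using f(2) by (cases "c' = b") (auto simp: is_leading_monomial_def lt_iff)
      qed
      then have "monomial_poly (exponent_map a b) \<in> weight_initial_ideal s w I"
        using f(1) False
        by (intro top_monomial_in_weight_initial_ideal[OF I mono, of "monomial_map a f"])
          (auto simp: contraction_def in_keys_iff)
      then show ?thesis ..
    qed
  next
    assume "b \<in> leading_monomials lt (toric_ideal r s a :: 'k mpoly set) \<or>
      monomial_poly (exponent_map a b) \<in> weight_initial_ideal s w I"
    then show "b \<in> leading_monomials ?lt (contraction r a I)"
    proof
      assume "b \<in> leading_monomials lt (toric_ideal r s a :: 'k mpoly set)"
      then obtain f :: "'k mpoly" where f: "f \<in> toric_ideal r s a" "is_leading_monomial lt f b"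
        by (auto simp: leading_monomials_def)
      have "?fiber f \<in> contraction r a I"
        using f(1) by (auto simp: toric_ideal_eq_contraction contraction_def monomial_map_fiber_part
          keys_terms_such_that ideal_mpoly_zero[OF I])
      moreover have "is_leading_monomial ?lt (?fiber f) b"
        unfolding fiber_leading by (rule restrict[OF f(2)])
      ultimately show ?thesis by (auto simp: leading_monomials_def)
    next
      let ?e = "exponent_map a b"
      assume "monomial_poly ?e \<in> weight_initial_ideal s w I"
      then obtain h where h: "h \<in> I" "\<forall>k\<in>Poly_Mapping.keys h. weight w k \<le> weight w ?e"
        "\<forall>k. weight w k = weight w ?e \<longrightarrow> Poly_Mapping.lookup h k = Poly_Mapping.lookup (monomial_poly ?e) k"
        by (rule weight_initial_ideal_component_lifts[OF I, of "monomial_poly ?e" w "weight w ?e"])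
      define h' where "h' = terms_such_that (\<lambda>c. multidegree v c = multidegree v ?e) h"
      have h'I: "h' \<in> I" unfolding h'_def by (rule comp[OF h(1)])
      have keys_h': "Poly_Mapping.keys h' \<subseteq> Poly_Mapping.keys h"
        by (auto simp: h'_def keys_terms_such_that)
      have lookup_h': "Poly_Mapping.lookup h' ?e = 1"
        using h(3) by (simp add: h'_def lookup_terms_such_that monomial_poly_def)
      have lower: "weight w k < weight w ?e" if "k \<in> Poly_Mapping.keys h'" "k \<noteq> ?e" for k
      proof (rule ccontr)
        assume "\<not> weight w k < weight w ?e"
        with that(1) keys_h' have "weight w k = weight w ?e" using h(2) by force
        then have "Poly_Mapping.lookup h k = 0"
          using h(3) that(2) by (simp add: monomial_poly_def lookup_single_not_eq)
        with that(1) keys_h' show False by (auto simp: in_keys_iff)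
      qed
      have "Poly_Mapping.keys h' \<subseteq> exponent_map a ` monomials r"
        using saturated[OF b] ideal_mpoly_keys[OF I h'I] by (auto simp: h'_def keys_terms_such_that)
      then obtain f where f: "f \<in> carrier (mpoly_ring r)" "monomial_map a f = h'"
        "Poly_Mapping.lookup f b = Poly_Mapping.lookup h' ?e"
        "\<forall>c\<in>Poly_Mapping.keys f. exponent_map a c \<in> Poly_Mapping.keys h'"
        "\<forall>c\<in>Poly_Mapping.keys f. exponent_map a c = ?e \<longrightarrow> c = b"
        using b by (rule monomial_map_lifting)
      have "f \<in> contraction r a I"
        using f(1,2) h'I by (simp add: contraction_def)
      moreover have "is_leading_monomial ?lt f b"
        unfolding is_leading_monomial_def lt_iff using f(3-5) lookup_h' lower by (auto simp: in_keys_iff[of b])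
      ultimately show ?thesis by (auto simp: leading_monomials_def)
    qed
  qed
qed

text \<open>
  The image of \<open>b\<close> is a product with one factor for each variable of \<open>b\<close>, counted with multiplicity. Going
  through the variables of \<open>m\<close> one by one, at most one further factor has to be selected for each of
  them.
\<close>
lemma small_divisor_with_divisible_image:
  assumes "monomial_dvd m (exponent_map a b)"
  obtains b' where "monomial_dvd b' b" "monomial_dvd m (exponent_map a b')"
    "weight (\<lambda>_. 1) b' \<le> weight (\<lambda>_. 1) m"
proof -
  have "\<exists>b'. monomial_dvd b' b \<and> monomial_dvd m (exponent_map a b') \<and> weight (\<lambda>_. 1) b' \<le> weight (\<lambda>_. 1) m"
    using assms
  proof (induction "weight (\<lambda>_. 1) m" arbitrary: m)
    case 0
    then have "m = 0" by (metis total_degree_eq_0_iff)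
    then show ?case by (intro exI[of _ 0]) (simp add: monomial_dvd_def)
  next
    case (Suc n)
    then have "m \<noteq> 0" by auto
    then obtain i where i: "Poly_Mapping.lookup m i \<noteq> 0"
      by (metis lookup_zero poly_mapping_eqI)
    then have "monomial_dvd (Poly_Mapping.single i 1) m"
      by (auto simp: monomial_dvd_def lookup_single when_def)
    then obtain m' where m: "m = Poly_Mapping.single i 1 + m'" by (rule monomial_dvdE)
    have deg_m: "weight (\<lambda>_. 1) m = Suc (weight (\<lambda>_. 1) m')" by (simp add: m weight_add)
    have "monomial_dvd m' (exponent_map a b)"
      using Suc.prems m monomial_dvd_add(2) monomial_dvd_trans by blast
    then obtain b' where b': "monomial_dvd b' b" "monomial_dvd m' (exponent_map a b')"
        "weight (\<lambda>_. 1) b' \<le> weight (\<lambda>_. 1) m'"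
      using Suc.hyps deg_m by (metis Suc_inject)
    show ?case
    proof (cases "monomial_dvd m (exponent_map a b')")
      case True
      with b' deg_m show ?thesis by (intro exI[of _ b']) simp
    next
      case False
      \<comment> \<open>Every exponent of \<open>m\<close> except possibly the one of \<open>i\<close> is covered by \<open>b'\<close> already.\<close>
      have less: "Poly_Mapping.lookup (exponent_map a b') i < Poly_Mapping.lookup (exponent_map a b) i"
      proof (rule ccontr)
        assume "\<not> ?thesis"
        moreover have "Poly_Mapping.lookup m i \<le> Poly_Mapping.lookup (exponent_map a b) i"
          using Suc.prems by (simp add: monomial_dvd_def)
        ultimately have "Poly_Mapping.lookup m j \<le> Poly_Mapping.lookup (exponent_map a b') j" for j
          using b'(2) by (cases "j = i") (simp_all add: monomial_dvd_def m lookup_add lookup_single)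
        with False show False by (simp add: monomial_dvd_def)
      qed
      obtain d where d: "b = b' + d" using b'(1) by (rule monomial_dvdE)
      have "Poly_Mapping.lookup (exponent_map a d) i \<noteq> 0"
        using less by (simp add: d exponent_map_add lookup_add)
      then obtain j where j: "j \<in> Poly_Mapping.keys d" "Poly_Mapping.lookup (a j) i \<noteq> 0"
        using lookup_exponent_map_neq_0_iff by blast
      let ?b = "b' + Poly_Mapping.single j 1"
      have "monomial_dvd ?b b"
        using j(1) by (auto simp: d monomial_dvd_def lookup_add lookup_single when_def in_keys_iff)
      moreover have "monomial_dvd m (exponent_map a ?b)"
        unfolding monomial_dvd_def
      proof
        fix k
        have "Poly_Mapping.lookup m' k \<le> Poly_Mapping.lookup (exponent_map a b') k"
          using b'(2) by (simp add: monomial_dvd_def)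
        then show "Poly_Mapping.lookup m k \<le> Poly_Mapping.lookup (exponent_map a ?b) k"
          using j(2) by (cases "k = i") (simp_all add: m exponent_map_add lookup_add lookup_single)
      qed
      moreover have "weight (\<lambda>_. 1) ?b \<le> weight (\<lambda>_. 1) m"
        using b'(3) deg_m by (simp add: weight_add)
      ultimately show ?thesis by blast
    qed
  qed
  then show ?thesis using that by blast
qed

text \<open>
  A variable divides the image of \<open>b\<close> as soon as it divides the image of one variable occurring in
  \<open>b\<close>, whatever the multiplicity.
\<close>
lemma squarefree_dvd_exponent_map_radical:
  assumes sqfree: "\<forall>i. Poly_Mapping.lookup m i \<le> 1" and dvd: "monomial_dvd m (exponent_map a b)"
  shows "monomial_dvd m (exponent_map a (monomial_radical b))"
  unfolding monomial_dvd_def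
proof
  fix i
  show "Poly_Mapping.lookup m i \<le> Poly_Mapping.lookup (exponent_map a (monomial_radical b)) i"
  proof (cases "Poly_Mapping.lookup m i = 0")
    case False
    then have "Poly_Mapping.lookup (exponent_map a b) i \<noteq> 0"
      using dvd by (metis monomial_dvd_def le_zero_eq)
    then obtain j where "j \<in> Poly_Mapping.keys b" "Poly_Mapping.lookup (a j) i \<noteq> 0"
      using lookup_exponent_map_neq_0_iff by blast
    then have "Poly_Mapping.lookup (exponent_map a (monomial_radical b)) i \<noteq> 0"
      unfolding lookup_exponent_map_neq_0_iff by auto
    moreover have "Poly_Mapping.lookup m i \<le> 1" using sqfree by blast
    ultimately show ?thesis by linarith
  qed simp
qed

theorem theorem3p16:
  fixes r s :: nat
    and v :: "nat \<Rightarrow> int ^ 'd"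
    and H :: "(int ^ 'd) set"
    and a :: "nat \<Rightarrow> monomial"
    and I :: "'k::field mpoly set"
    and lt :: "monomial \<Rightarrow> monomial \<Rightarrow> bool"
    and w :: "nat \<Rightarrow> nat"
  assumes "finitely_generated_semigroup H"
    and "H \<subseteq> column_semigroup s v"
    and "finitely_generated_semigroup (lifted_semigroup s v H)"
    and "\<forall>i<r. a i \<in> monomials s"
    and "lifted_semigroup s v H = subsemigroup hull (a ` {..<r})"
    and "graded_ideal s v I"
    and "term_order r lt"
    and "monomial_ideal s (weight_initial_ideal s w I)"
  shows "delta r (initial_ideal r (weight_order (\<lambda>i. weight w (a i)) lt) (contraction r a I))
           \<le> max (delta s (weight_initial_ideal s w I))
                 (delta r (initial_ideal r lt (toric_ideal r s a :: 'k mpoly set))) \<and>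
         (squarefree_monomial_ideal s (weight_initial_ideal s w I) \<and>
          squarefree_monomial_ideal r (initial_ideal r lt (toric_ideal r s a :: 'k mpoly set)) \<longrightarrow>
          squarefree_monomial_ideal r
            (initial_ideal r (weight_order (\<lambda>i. weight w (a i)) lt) (contraction r a I)))"
proof -
  let ?lt = "weight_order (\<lambda>i. weight w (a i)) lt"
  let ?J = "contraction r a I" and ?P = "toric_ideal r s a :: 'k mpoly set"
  let ?L = "leading_monomials ?lt ?J"
  let ?in = "weight_initial_ideal s w I"
  let ?inJ = "initial_ideal r ?lt ?J" and ?inP = "initial_ideal r lt ?P"
  have a: "a ` {..<r} \<subseteq> monomials s" using assms(4) by auto
  have I: "ideal I (mpoly_ring s)" using assms(6) by (simp add: graded_ideal_def)
  have J: "ideal ?J (mpoly_ring r)" by (rule ideal_contraction[OF a I])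
  have P: "ideal ?P (mpoly_ring r)"
    unfolding toric_ideal_eq_contraction by (rule ideal_contraction[OF a ideal_zero_mpoly])
  have L_sub: "?L \<subseteq> monomials r" by (rule leading_monomials_subset[OF J])
  have lifted: "lifted_semigroup s v H = exponent_map a ` monomials r"
    using assms(5) by (simp only: subsemigroup_hull_eq_image_exponent_map)
  \<comment> \<open>The image is the preimage of \<open>H\<close> under the multidegree, so it contains full graded pieces.\<close>
  have saturated: "c \<in> exponent_map a ` monomials r"
    if "b \<in> monomials r" "c \<in> monomials s" "multidegree v c = multidegree v (exponent_map a b)" for b c
  proof -
    have "exponent_map a b \<in> lifted_semigroup s v H" using that(1) lifted by blast
    with that(2,3) have "c \<in> lifted_semigroup s v H" by (simp add: lifted_semigroup_def)
    then show ?thesis by (simp only: lifted)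
  qed
  have L_iff: "b \<in> ?L \<longleftrightarrow> b \<in> monomials r \<and>
      (b \<in> leading_monomials lt ?P \<or> monomial_poly (exponent_map a b) \<in> ?in)" for b
  proof (cases "b \<in> monomials r")
    case True
    have "b \<in> ?L \<longleftrightarrow> b \<in> leading_monomials lt ?P \<or> monomial_poly (exponent_map a b) \<in> ?in"
    proof (rule leading_monomials_contraction_iff[OF I assms(8) _ saturated True])
      show "terms_such_that (\<lambda>c. multidegree v c = u) f \<in> I" if "f \<in> I" for f u
        using assms(6) that by (simp add: graded_ideal_def)
    qed
    with True show ?thesis by simp
  next
    case False
    with L_sub show ?thesis by auto
  qed
  have inJ_iff: "monomial_poly b \<in> ?inJ \<longleftrightarrow> b \<in> ?L" for b
    by (rule monomial_poly_in_initial_ideal_iff[OF J term_order_weight_order[OF assms(7)]])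
  have inP_iff: "monomial_poly b \<in> ?inP \<longleftrightarrow> b \<in> leading_monomials lt ?P" for b
    by (rule monomial_poly_in_initial_ideal_iff[OF P assms(7)])
  have image_in_monomials: "exponent_map a b \<in> monomials s" if "b \<in> monomials r" for b
    by (rule exponent_map_in_subsemigroup[OF subsemigroup_monomials a that])
  have degree_bound: "weight (\<lambda>_. 1) b \<le> max (delta s ?in) (delta r ?inP)"
    if b: "b \<in> minimal_monomial_generators r ?inJ" for b
  proof (cases "b \<in> leading_monomials lt ?P")
    case True
    \<comment> \<open>Leading monomials of the toric ideal are leading monomials of the contraction, so \<open>b\<close> stays minimal.\<close>
    then have "b \<in> minimal_monomial_generators r ?inP"
      using b unfolding minimal_monomial_generators_iff inJ_iff inP_iff L_iff
      using monomial_dvd_in_monomials by blast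
    from degree_le_delta[OF this] show ?thesis by (rule max.coboundedI2)
  next
    case False
    then have br: "b \<in> monomials r" and "monomial_poly (exponent_map a b) \<in> ?in"
      using b by (auto simp: minimal_monomial_generators_iff inJ_iff L_iff)
    then obtain m where m: "m \<in> minimal_monomial_generators s ?in" "monomial_dvd m (exponent_map a b)"
      using obtain_minimal_monomial_generator[OF image_in_monomials] by blast
    obtain b' where b': "monomial_dvd b' b" "monomial_dvd m (exponent_map a b')"
        "weight (\<lambda>_. 1) b' \<le> weight (\<lambda>_. 1) m"
      by (rule small_divisor_with_divisible_image[OF m(2)])
    have b'r: "b' \<in> monomials r" using b'(1) br by (rule monomial_dvd_in_monomials)
    \<comment> \<open>The divisor \<open>b'\<close> gives a leading monomial of the contraction as well, so minimality forces equality.\<close>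
    have "monomial_poly m \<in> ?in" using m(1) by (simp only: minimal_monomial_generators_iff)
    then have "monomial_poly (exponent_map a b') \<in> ?in"
      by (rule monomial_ideal_upward_closed[OF assms(8) _ b'(2) image_in_monomials[OF b'r]])
    then have "monomial_poly b' \<in> ?inJ" using b'r unfolding inJ_iff L_iff by blast
    with b b'(1) have "b' = b" unfolding minimal_monomial_generators_iff by blast
    with b'(3) have "weight (\<lambda>_. 1) b \<le> weight (\<lambda>_. 1) m" by (simp only:)
    also have "\<dots> \<le> delta s ?in" by (rule degree_le_delta[OF m(1)])
    finally show ?thesis by (rule max.coboundedI1)
  qed
  have "delta r ?inJ \<le> max (delta s ?in) (delta r ?inP)"
    using degree_bound unfolding initial_ideal_eq[of r ?lt] by (rule delta_Idl_monomials_le[OF L_sub])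
  moreover have "squarefree_monomial_ideal r ?inJ"
    if sqfree: "squarefree_monomial_ideal s ?in" "squarefree_monomial_ideal r ?inP"
  proof -
    have "monomial_radical b \<in> ?L" if "b \<in> ?L" for b
    proof -
      have br: "b \<in> monomials r" using that L_sub by blast
      from that consider "b \<in> leading_monomials lt ?P" | "monomial_poly (exponent_map a b) \<in> ?in"
        unfolding L_iff by blast
      then show ?thesis
      proof cases
        case 1
        then have "monomial_poly b \<in> ?inP" by (simp only: inP_iff)
        then obtain m where m: "monomial_poly m \<in> ?inP" "\<forall>i. Poly_Mapping.lookup m i \<le> 1" "monomial_dvd m b"
          by (rule squarefree_monomial_ideal_generator[OF sqfree(2)])
        from m(2,3) have "monomial_dvd m (monomial_radical b)"
          by (intro squarefree_dvd_radical)
        then have "monomial_radical b \<in> leading_monomials lt ?P"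
          using br unfolding inP_iff[symmetric]
          by (intro monomial_ideal_upward_closed[OF monomial_ideal_initial_ideal[OF P] m(1)]) simp_all
        with br show ?thesis by (simp add: L_iff)
      next
        case 2
        then obtain m where m: "monomial_poly m \<in> ?in" "\<forall>i. Poly_Mapping.lookup m i \<le> 1"
            "monomial_dvd m (exponent_map a b)"
          by (rule squarefree_monomial_ideal_generator[OF sqfree(1)])
        have "monomial_poly (exponent_map a (monomial_radical b)) \<in> ?in"
          using br by (intro monomial_ideal_upward_closed[OF assms(8) m(1)]
            squarefree_dvd_exponent_map_radical m image_in_monomials) simp
        with br show ?thesis by (simp add: L_iff)
      qed
    qed
    then show ?thesis
      unfolding initial_ideal_eq by (intro squarefree_Idl_of_radical_closed L_sub)
  qed
  ultimately show ?thesis by blast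
qed

end
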